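(* Let $M$ be a monoid generated by a set $S$. The correspondence $\mathbf{w}\mapsto P(\mathbf{w})$ establishes a bijection between commutation classes of words in $S$ and isomorphism classes of word posets.
   Context: $S^{\ast}$ is the free monoid of finite words in $S$; $\mathbf{w}_i$ is the $i$-th letter of $\mathbf{w}$ and $\ell(\mathbf{w})$ its length; $[n]=\{1,\dots,n\}$. A monoid $M$ generated by $S$ is a quotient of $S^{\ast}$ by some relations. A relation of the form $ab=ba$ with $a,b\in S$ is called a commutation relation, and then $a$ and $b$ are said to commute. Two words are in the same commutation class if they are equivalent using only a sequence of commutation relations, i.e. one is obtained from the other by repeatedly swapping adjacent commuting letters. A word poset is a poset $P$ with a function $s:P\to S$ such that for all $u,v\in P$: (a) if $s(u)$ and $s(v)$ are equal or do not commute, then $u$ and $v$ are comparable; (b) if $v$ covers $u$, then $s(u)$ and $s(v)$ either do not commute or are equal. An isomorphism of word posets $f:(P,s)\to(P',s')$ is a poset isomorphism with $s'\circ f=s$. For a word $\mathbf{w}$, define a relation $\to$ on $[\ell(\mathbf{w})]$ by $i\to j$ iff $i\le j$ and $\mathbf{w}_i,\mathbf{w}_j$ either are equal or do not commute. Let $\leq_{\mathbf{w}}$ be the transitive closure of $\to$; it is a partial order. $P(\mathbf{w})$ is the poset $([\ell(\mathbf{w})],\leq_{\mathbf{w}})$ with labelling $i\mapsto\mathbf{w}_i$; it is a word poset.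
   Formalization: Word posets are required to be finite; without this the claim fails, e.g. the infinite chain of natural numbers with all labels equal to one letter is a word poset but is not isomorphic to P(w) for any finite word w. *)

theory Defs
  imports "HOL-Algebra.Group"
begin

inductive_set relation_congruence :: "'a set \<Rightarrow> ('a list \<times> 'a list) set \<Rightarrow> ('a list \<times> 'a list) set"
  for S :: "'a set" and R :: "('a list \<times> 'a list) set"
where
  base: "(u, v) \<in> R \<Longrightarrow> u \<in> lists S \<Longrightarrow> v \<in> lists S \<Longrightarrow> (u, v) \<in> relation_congruence S R"
| refl: "u \<in> lists S \<Longrightarrow> (u, u) \<in> relation_congruence S R"
| sym: "(u, v) \<in> relation_congruence S R \<Longrightarrow> (v, u) \<in> relation_congruence S R"
| trans: "(u, v) \<in> relation_congruence S R \<Longrightarrow> (v, w) \<in> relation_congruence S R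
    \<Longrightarrow> (u, w) \<in> relation_congruence S R"
| append: "(u, v) \<in> relation_congruence S R \<Longrightarrow> (u', v') \<in> relation_congruence S R
    \<Longrightarrow> (u @ u', v @ v') \<in> relation_congruence S R"

definition word_class :: "'a set \<Rightarrow> ('a list \<times> 'a list) set \<Rightarrow> 'a list \<Rightarrow> 'a list set" where
  "word_class S R w = relation_congruence S R `` {w}"

text \<open>The quotient of the free monoid on \<open>S\<close> by the relations \<open>R\<close>. Distinct letters
  of \<open>S\<close> may become equal in the quotient.\<close>

definition presented_monoid :: "'a set \<Rightarrow> ('a list \<times> 'a list) set \<Rightarrow> 'a list set monoid" where
  "presented_monoid S R =
     \<lparr>carrier = lists S // relation_congruence S R,
      mult = (\<lambda>X Y. \<Union>u\<in>X. \<Union>v\<in>Y. word_class S R (u @ v)),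
      one = word_class S R []\<rparr>"

definition commute :: "'a set \<Rightarrow> ('a list \<times> 'a list) set \<Rightarrow> 'a \<Rightarrow> 'a \<Rightarrow> bool" where
  "commute S R a b \<longleftrightarrow> a \<in> S \<and> b \<in> S \<and>
     word_class S R [a] \<otimes>\<^bsub>presented_monoid S R\<^esub> word_class S R [b] =
     word_class S R [b] \<otimes>\<^bsub>presented_monoid S R\<^esub> word_class S R [a]"

definition commutation_move :: "'a set \<Rightarrow> ('a list \<times> 'a list) set \<Rightarrow> ('a list \<times> 'a list) set" where
  "commutation_move S R =
     {(u @ [a, b] @ v, u @ [b, a] @ v) | u v a b.
        u \<in> lists S \<and> v \<in> lists S \<and> commute S R a b}"

definition commutation_equiv :: "'a set \<Rightarrow> ('a list \<times> 'a list) set \<Rightarrow> ('a list \<times> 'a list) set" where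
  "commutation_equiv S R = (commutation_move S R)\<^sup>* \<inter> lists S \<times> lists S"

record ('p, 'a) labelled_poset =
  elems :: "'p set"
  order_rel :: "('p \<times> 'p) set"
  label :: "'p \<Rightarrow> 'a"

definition covers :: "('p \<times> 'p) set \<Rightarrow> 'p \<Rightarrow> 'p \<Rightarrow> bool" where
  "covers r v u \<longleftrightarrow> (u, v) \<in> r \<and> u \<noteq> v \<and>
     (\<forall>x. (u, x) \<in> r \<and> (x, v) \<in> r \<longrightarrow> x = u \<or> x = v)"

text \<open>Posets are finite: an infinite poset never comes from a (finite) word.\<close>

definition word_poset ::
  "'a set \<Rightarrow> ('a list \<times> 'a list) set \<Rightarrow> ('p, 'a) labelled_poset \<Rightarrow> bool" where
  "word_poset S R P \<longleftrightarrow>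
     finite (elems P) \<and>
     partial_order_on (elems P) (order_rel P) \<and>
     label P \<in> elems P \<rightarrow> S \<and>
     (\<forall>u\<in>elems P. \<forall>v\<in>elems P.
        (label P u = label P v \<or> \<not> commute S R (label P u) (label P v) \<longrightarrow>
           (u, v) \<in> order_rel P \<or> (v, u) \<in> order_rel P) \<and>
        (covers (order_rel P) v u \<longrightarrow>
           \<not> commute S R (label P u) (label P v) \<or> label P u = label P v))"

definition word_poset_isomorphism ::
  "('p, 'a) labelled_poset \<Rightarrow> ('q, 'a) labelled_poset \<Rightarrow> ('p \<Rightarrow> 'q) \<Rightarrow> bool" where
  "word_poset_isomorphism P Q f \<longleftrightarrow>
     bij_betw f (elems P) (elems Q) \<and>
     (\<forall>u\<in>elems P. \<forall>v\<in>elems P. (u, v) \<in> order_rel P \<longleftrightarrow> (f u, f v) \<in> order_rel Q) \<and>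
     (\<forall>u\<in>elems P. label Q (f u) = label P u)"

definition word_poset_isomorphic ::
  "('p, 'a) labelled_poset \<Rightarrow> ('q, 'a) labelled_poset \<Rightarrow> bool" where
  "word_poset_isomorphic P Q \<longleftrightarrow> (\<exists>f. word_poset_isomorphism P Q f)"

definition isomorphism_rel ::
  "'a set \<Rightarrow> ('a list \<times> 'a list) set \<Rightarrow>
   (('p, 'a) labelled_poset \<times> ('p, 'a) labelled_poset) set" where
  "isomorphism_rel S R =
     {(P, Q). word_poset S R P \<and> word_poset S R Q \<and> word_poset_isomorphic P Q}"

text \<open>Positions are counted from 1, so the \<open>i\<close>-th letter of \<open>w\<close> is \<open>w ! (i - 1)\<close>.\<close>

definition word_arrow :: "'a set \<Rightarrow> ('a list \<times> 'a list) set \<Rightarrow> 'a list \<Rightarrow> (nat \<times> nat) set" where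
  "word_arrow S R w =
     {(i, j). i \<in> {1..length w} \<and> j \<in> {1..length w} \<and> i \<le> j \<and>
        (w ! (i - 1) = w ! (j - 1) \<or> \<not> commute S R (w ! (i - 1)) (w ! (j - 1)))}"

definition poset_of_word ::
  "'a set \<Rightarrow> ('a list \<times> 'a list) set \<Rightarrow> 'a list \<Rightarrow> (nat, 'a) labelled_poset" where
  "poset_of_word S R w =
     \<lparr>elems = {1..length w},
      order_rel = (word_arrow S R w)\<^sup>+,
      label = (\<lambda>i. w ! (i - 1))\<rparr>"

lemma relation_congruence_lists:
  "(u, v) \<in> relation_congruence S R \<Longrightarrow> u \<in> lists S \<and> v \<in> lists S"
  by (induction rule: relation_congruence.induct) auto

lemma equiv_relation_congruence: "equiv (lists S) (relation_congruence S R)"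
proof (rule equivI)
  show "relation_congruence S R \<subseteq> lists S \<times> lists S"
    by (rule subrelI) (drule relation_congruence_lists, simp)
  show "refl_on (lists S) (relation_congruence S R)"
    by (rule refl_onI) (rule relation_congruence.refl)
  show "sym (relation_congruence S R)"
    by (rule symI) (rule relation_congruence.sym)
  show "trans (relation_congruence S R)"
    by (rule transI) (rule relation_congruence.trans)
qed

lemma word_class_eq_iff:
  assumes "u \<in> lists S" "v \<in> lists S"
  shows "word_class S R u = word_class S R v \<longleftrightarrow> (u, v) \<in> relation_congruence S R"
  unfolding word_class_def by (rule eq_equiv_class_iff[OF equiv_relation_congruence assms])

lemma mult_word_class:
  assumes "u \<in> lists S" "v \<in> lists S"
  shows "word_class S R u \<otimes>\<^bsub>presented_monoid S R\<^esub> word_class S R v = word_class S R (u @ v)"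
proof -
  have eq: "word_class S R (x @ y) = word_class S R (u @ v)"
    if "x \<in> word_class S R u" "y \<in> word_class S R v" for x y
  proof -
    have "(u @ v, x @ y) \<in> relation_congruence S R"
      using that unfolding word_class_def by (simp add: relation_congruence.append)
    then show ?thesis
      unfolding word_class_def
      by (rule equiv_class_eq[OF equiv_relation_congruence, symmetric])
  qed
  have "u \<in> word_class S R u" "v \<in> word_class S R v"
    using assms unfolding word_class_def by (simp_all add: relation_congruence.refl del: in_lists_conv_set)
  then have "(\<Union>x\<in>word_class S R u. \<Union>y\<in>word_class S R v. word_class S R (x @ y)) =
      word_class S R (u @ v)"
    using eq by blast
  then show ?thesis
    by (simp add: presented_monoid_def)
qed

lemma carrier_presented_monoid: "carrier (presented_monoid S R) = word_class S R ` lists S"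
  by (auto simp: presented_monoid_def quotient_def word_class_def)

lemma one_presented_monoid: "\<one>\<^bsub>presented_monoid S R\<^esub> = word_class S R []"
  by (simp add: presented_monoid_def)

lemma monoid_presented_monoid: "Group.monoid (presented_monoid S R)"
proof (rule monoidI)
  fix x y
  assume "x \<in> carrier (presented_monoid S R)" "y \<in> carrier (presented_monoid S R)"
  then obtain u v where u: "u \<in> lists S" "x = word_class S R u"
    and v: "v \<in> lists S" "y = word_class S R v"
    unfolding carrier_presented_monoid by blast
  have "u @ v \<in> lists S"
    using u(1) v(1) by auto
  then show "x \<otimes>\<^bsub>presented_monoid S R\<^esub> y \<in> carrier (presented_monoid S R)"
    unfolding u(2) v(2) mult_word_class[OF u(1) v(1)] carrier_presented_monoid by (rule imageI)
next
  show "\<one>\<^bsub>presented_monoid S R\<^esub> \<in> carrier (presented_monoid S R)"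
    unfolding one_presented_monoid carrier_presented_monoid by blast
next
  fix x y z
  assume "x \<in> carrier (presented_monoid S R)" "y \<in> carrier (presented_monoid S R)"
    "z \<in> carrier (presented_monoid S R)"
  then obtain u v w where u: "u \<in> lists S" "x = word_class S R u"
    and v: "v \<in> lists S" "y = word_class S R v" and w: "w \<in> lists S" "z = word_class S R w"
    unfolding carrier_presented_monoid by blast
  have uv: "u @ v \<in> lists S" and vw: "v @ w \<in> lists S"
    using u(1) v(1) w(1) by auto
  show "x \<otimes>\<^bsub>presented_monoid S R\<^esub> y \<otimes>\<^bsub>presented_monoid S R\<^esub> z =
      x \<otimes>\<^bsub>presented_monoid S R\<^esub> (y \<otimes>\<^bsub>presented_monoid S R\<^esub> z)"
    unfolding u(2) v(2) w(2) mult_word_class[OF u(1) v(1)] mult_word_class[OF v(1) w(1)]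
      mult_word_class[OF uv w(1)] mult_word_class[OF u(1) vw] by simp
next
  fix x
  assume "x \<in> carrier (presented_monoid S R)"
  then obtain u where u: "u \<in> lists S" "x = word_class S R u"
    unfolding carrier_presented_monoid by blast
  have e: "[] \<in> lists S"
    by simp
  show "\<one>\<^bsub>presented_monoid S R\<^esub> \<otimes>\<^bsub>presented_monoid S R\<^esub> x = x"
    unfolding one_presented_monoid u(2) mult_word_class[OF e u(1)] by simp
  show "x \<otimes>\<^bsub>presented_monoid S R\<^esub> \<one>\<^bsub>presented_monoid S R\<^esub> = x"
    unfolding one_presented_monoid u(2) mult_word_class[OF u(1) e] by simp
qed

lemma commute_iff:
  "commute S R a b \<longleftrightarrow> a \<in> S \<and> b \<in> S \<and> ([a, b], [b, a]) \<in> relation_congruence S R"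
proof (cases "a \<in> S \<and> b \<in> S")
  case True
  then show ?thesis
    by (simp add: commute_def mult_word_class word_class_eq_iff)
next
  case False
  then show ?thesis
    unfolding commute_def by blast
qed

end

theory Submission
  imports Defs
begin

text \<open>The words read off from the linear extensions of a word poset \<open>Q\<close> are exactly the words
  \<open>w\<close> with \<open>P(w)\<close> isomorphic to \<open>Q\<close>: condition (a) makes the listing order-preserving from \<open>P(w)\<close>
  to \<open>Q\<close>, and since a finite order is generated by its covering pairs, condition (b) gives the
  converse. Any two linear extensions of \<open>Q\<close> are connected by commutations: the first element of
  one is incomparable to everything in front of it in the other, so it can be moved to the
  front.\<close>

section \<open>Linear extensions\<close>

text \<open>Phrased negatively, as the absence of inversions, so that it passes to sublists and also
  makes sense for a bare relation. The carrier enters only later, as \<open>set xs\<close>.\<close>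

definition linear_extension :: "('p \<times> 'p) set \<Rightarrow> 'p list \<Rightarrow> bool" where
  "linear_extension r xs \<longleftrightarrow> distinct xs \<and> sorted_wrt (\<lambda>x y. (y, x) \<notin> r) xs"

lemma linear_extension_nth_le:
  assumes "linear_extension r xs" "(xs ! i, xs ! j) \<in> r" "i < length xs" "j < length xs"
  shows "i \<le> j"
  using assms unfolding linear_extension_def sorted_wrt_iff_nth_less
  by (meson not_le)

text \<open>A new element \<open>x\<close> is inserted right after the block of the elements below
  it. Antisymmetry keeps that block from containing anything above \<open>x\<close>; transitivity
  keeps the elements behind \<open>x\<close> from lying below an element of the block.\<close>

lemma ex_linear_extension:
  assumes "finite A" "antisym r" "trans r"
  shows "\<exists>xs. set xs = A \<and> linear_extension r xs"
  using assms(1)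
proof (induction rule: finite_induct)
  case empty
  then show ?case by (simp add: linear_extension_def)
next
  case (insert x A)
  then obtain xs where xs: "set xs = A" "linear_extension r xs" by blast
  let ?ys = "filter (\<lambda>y. (y, x) \<in> r) xs @ x # filter (\<lambda>y. (y, x) \<notin> r) xs"
  have "(x, y) \<notin> r" if "y \<in> A" "(y, x) \<in> r" for y
    using antisymD[OF assms(2) that(2)] that(1) insert.hyps(2) by blast
  moreover have "(z, y) \<notin> r" if "(y, x) \<in> r" "(z, x) \<notin> r" for y z
    using transD[OF assms(3) _ that(1)] that(2) by blast
  ultimately have "set ?ys = insert x A \<and> linear_extension r ?ys"
    using xs insert.hyps(2) unfolding linear_extension_def
    by (auto simp: sorted_wrt_append sorted_wrt_filter)
  then show ?case by blast
qed

text \<open>Induction on the size of the interval from \<open>x\<close> to \<open>y\<close>. If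
  \<open>y\<close> neither equals nor covers \<open>x\<close>, some \<open>z\<close> lies strictly
  between, and the intervals from \<open>x\<close> to \<open>z\<close> and from \<open>z\<close> to
  \<open>y\<close> are smaller: the first misses \<open>y\<close>, the second misses
  \<open>x\<close>.\<close>

lemma finite_order_generated_by_covers:
  assumes "finite A" "partial_order_on A r" "(x, y) \<in> r"
  shows "(x, y) \<in> {(u, v). covers r v u}\<^sup>*"
  using assms(3)
proof (induction "card {z. (x, z) \<in> r \<and> (z, y) \<in> r}" arbitrary: x y rule: less_induct)
  case less
  have r: "r \<subseteq> A \<times> A" "refl_on A r" "trans r" "antisym r"
    using assms(2) by (auto simp: partial_order_on_def preorder_on_def)
  have fin: "finite {z. (x, z) \<in> r \<and> (z, y) \<in> r}"
    by (rule finite_subset[OF _ assms(1)]) (use r(1) in auto)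
  have self: "(x, x) \<in> r" "(y, y) \<in> r"
    using less.prems r(1,2) by (auto simp: refl_on_def)
  show ?case
  proof (cases "x = y \<or> covers r y x")
    case True
    then show ?thesis by auto
  next
    case False
    then obtain z where z: "(x, z) \<in> r" "(z, y) \<in> r" "z \<noteq> x" "z \<noteq> y"
      using less.prems by (auto simp: covers_def)
    have "{t. (x, t) \<in> r \<and> (t, z) \<in> r} \<subset> {t. (x, t) \<in> r \<and> (t, y) \<in> r}"
      using z self transD[OF r(3)] antisymD[OF r(4)] by blast
    from less.hyps[OF psubset_card_mono[OF fin this] z(1)]
    have 1: "(x, z) \<in> {(u, v). covers r v u}\<^sup>*" .
    have "{t. (z, t) \<in> r \<and> (t, y) \<in> r} \<subset> {t. (x, t) \<in> r \<and> (t, y) \<in> r}"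
      using z self transD[OF r(3)] antisymD[OF r(4)] by blast
    from less.hyps[OF psubset_card_mono[OF fin this] z(2)] 1
    show ?thesis by (meson rtrancl_trans)
  qed
qed

section \<open>Commutation classes\<close>

lemma commute_sym: "commute S R a b \<Longrightarrow> commute S R b a"
  unfolding commute_def by simp

lemma commutation_moveI:
  assumes "u \<in> lists S" "v \<in> lists S" "commute S R a b"
  shows "(u @ [a, b] @ v, u @ [b, a] @ v) \<in> commutation_move S R"
  unfolding commutation_move_def using assms by blast

lemma commutation_move_rtrancl_Cons:
  assumes "(u, v) \<in> (commutation_move S R)\<^sup>*" "a \<in> S"
  shows "(a # u, a # v) \<in> (commutation_move S R)\<^sup>*"
  using assms(1)
proof (induction rule: rtrancl_induct)
  case (step y z)
  then obtain p q b c where "y = p @ [b, c] @ q" "z = p @ [c, b] @ q"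
    "p \<in> lists S" "q \<in> lists S" "commute S R b c"
    unfolding commutation_move_def by blast
  then have "(a # y, a # z) \<in> commutation_move S R"
    using commutation_moveI[of "a # p" S q] assms(2) by simp
  with step.IH show ?case by (meson rtrancl.rtrancl_into_rtrancl)
qed simp

lemma commutation_move_to_front:
  assumes "\<And>b. b \<in> set u \<Longrightarrow> commute S R a b" "a \<in> S" "u \<in> lists S" "v \<in> lists S"
  shows "(a # u @ v, u @ a # v) \<in> (commutation_move S R)\<^sup>*"
  using assms(1,3)
proof (induction u)
  case (Cons b u)
  have "(a # b # u @ v, b # a # u @ v) \<in> commutation_move S R"
    using commutation_moveI[of "[]" S "u @ v"] Cons.prems assms(4) by auto
  moreover have "(b # a # u @ v, b # u @ a # v) \<in> (commutation_move S R)\<^sup>*"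
    using Cons by (intro commutation_move_rtrancl_Cons) auto
  ultimately show ?case by (simp add: converse_rtrancl_into_rtrancl)
qed simp

text \<open>The comparability hypothesis is the part of (a) about noncommuting letters, restricted
  to \<open>set xs\<close>. It is inherited by the tail of \<open>xs\<close>, so the induction can
  delete the head from both lists.\<close>

lemma linear_extensions_commutation_equivalent:
  assumes "linear_extension r xs" "linear_extension r ys" "set xs = set ys"
    and "l ` set xs \<subseteq> S"
    and "\<And>u v. u \<in> set xs \<Longrightarrow> v \<in> set xs \<Longrightarrow> \<not> commute S R (l u) (l v) \<Longrightarrow>
           (u, v) \<in> r \<or> (v, u) \<in> r"
  shows "(map l xs, map l ys) \<in> (commutation_move S R)\<^sup>*"
  using assms
proof (induction xs arbitrary: ys)
  case (Cons x xs)
  then obtain ys1 ys2 where ys: "ys = ys1 @ x # ys2"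
    by (metis list.set_intros(1) split_list)
  have set: "set xs = set (ys1 @ ys2)"
    using Cons.prems(1-3) unfolding ys linear_extension_def by auto
  have "(map l xs, map l (ys1 @ ys2)) \<in> (commutation_move S R)\<^sup>*"
  proof (rule Cons.IH[OF _ _ set])
    show "linear_extension r xs" "linear_extension r (ys1 @ ys2)"
      using Cons.prems(1,2) unfolding ys linear_extension_def by (auto simp: sorted_wrt_append)
  qed (use Cons.prems(4,5) in auto)
  then have "(l x # map l xs, l x # map l ys1 @ map l ys2) \<in> (commutation_move S R)\<^sup>*"
    using Cons.prems(4) by (auto intro: commutation_move_rtrancl_Cons)
  moreover have "(l x # map l ys1 @ map l ys2, map l ys1 @ l x # map l ys2)
      \<in> (commutation_move S R)\<^sup>*"
  proof (rule commutation_move_to_front)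
    fix b assume "b \<in> set (map l ys1)"
    then obtain y where y: "y \<in> set ys1" "b = l y" by auto
    \<comment> \<open>The first fact holds because \<open>y\<close> precedes \<open>x\<close> in
      \<open>ys\<close>, the second because \<open>x\<close> precedes \<open>y\<close> in
      \<open>x # xs\<close>.\<close>
    then have "(x, y) \<notin> r" "(y, x) \<notin> r"
      using Cons.prems(1,2) set unfolding ys linear_extension_def
      by (auto simp: sorted_wrt_append)
    then show "commute S R (l x) b"
      using Cons.prems(5)[of x y] y set by auto
  qed (use Cons.prems(4) set in \<open>auto simp: image_subset_iff\<close>)
  ultimately have "(l x # map l xs, map l ys1 @ l x # map l ys2) \<in> (commutation_move S R)\<^sup>*"
    by (rule rtrancl_trans)
  then show ?case unfolding ys by simp
qed simp

lemma equiv_commutation_equiv: "equiv (lists S) (commutation_equiv S R)"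
proof (rule equivI)
  have "sym (commutation_move S R)"
    unfolding commutation_move_def sym_def by (blast intro: commute_sym)
  then have "sym ((commutation_move S R)\<^sup>*)" by (rule sym_rtrancl)
  then show "sym (commutation_equiv S R)"
    unfolding commutation_equiv_def sym_def by blast
  show "trans (commutation_equiv S R)"
    unfolding commutation_equiv_def by (auto intro!: transI intro: rtrancl_trans)
qed (auto simp: commutation_equiv_def refl_on_def)

section \<open>The word poset of a word\<close>

text \<open>This yields antisymmetry of the order of P(w) and makes the increasing list of positions
  a linear extension of it.\<close>

lemma word_arrow_trancl_le:
  assumes "(i, j) \<in> (word_arrow S R w)\<^sup>+"
  shows "i \<le> j \<and> i \<in> {1..length w} \<and> j \<in> {1..length w}"
  using assms by (induction rule: trancl_induct) (auto simp: word_arrow_def)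

text \<open>\<open>word_arrow\<close> contains loops, so a chain of arrows may linger at its start
  before it really moves.\<close>

lemma trancl_first_proper_step:
  assumes "(x, y) \<in> r\<^sup>+" "x \<noteq> y"
  shows "\<exists>z. z \<noteq> x \<and> (x, z) \<in> r \<and> (z, y) \<in> r\<^sup>*"
  using assms
proof (induction rule: converse_trancl_induct)
  case (base u)
  then show ?case by (intro exI[of _ y]) simp
next
  case (step u z)
  then show ?case by (metis trancl_into_rtrancl)
qed

text \<open>The first arrow that leaves \<open>i\<close> on a chain to \<open>j\<close> ends at some
  \<open>k\<close> between them in the order. A covering pair has nothing strictly between, so
  \<open>k = j\<close>. This gives (b) for P(w).\<close>

lemma word_arrow_covers:
  assumes "covers ((word_arrow S R w)\<^sup>+) j i"
  shows "(i, j) \<in> word_arrow S R w"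
proof -
  have ij: "(i, j) \<in> (word_arrow S R w)\<^sup>+" "i \<noteq> j"
    using assms by (auto simp: covers_def)
  from trancl_first_proper_step[OF this] obtain k where
    k: "k \<noteq> i" "(i, k) \<in> word_arrow S R w" "(k, j) \<in> (word_arrow S R w)\<^sup>*" by blast
  have "k = j"
  proof (rule ccontr)
    assume "k \<noteq> j"
    then have "(k, j) \<in> (word_arrow S R w)\<^sup>+" using k(3) by (simp add: rtrancl_eq_or_trancl)
    then show False using assms k \<open>k \<noteq> j\<close> by (auto simp: covers_def)
  qed
  then show ?thesis using k by simp
qed

lemma word_poset_poset_of_word:
  assumes "w \<in> lists S"
  shows "word_poset S R (poset_of_word S R w)"
proof -
  let ?r = "(word_arrow S R w)\<^sup>+"
  have "partial_order_on {1..length w} ?r"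
    unfolding partial_order_on_def preorder_on_def
  proof (intro conjI)
    show "?r \<subseteq> {1..length w} \<times> {1..length w}"
      using word_arrow_trancl_le by fast
    show "refl_on {1..length w} ?r"
      by (rule refl_onI) (auto simp: word_arrow_def)
    show "antisym ?r"
      by (rule antisymI) (auto dest!: word_arrow_trancl_le)
  qed simp
  moreover have "(i, j) \<in> ?r \<or> (j, i) \<in> ?r"
    if "i \<in> {1..length w}" "j \<in> {1..length w}"
      "w ! (i - 1) = w ! (j - 1) \<or> \<not> commute S R (w ! (i - 1)) (w ! (j - 1))" for i j
  proof -
    \<comment> \<open>Arrows point to the larger position. If that is \<open>i\<close>, the labels
      are compared in the other order, whence \<open>commute_sym\<close>.\<close>
    have "(i, j) \<in> word_arrow S R w \<or> (j, i) \<in> word_arrow S R w"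
      using that linear[of i j] unfolding word_arrow_def by (auto dest: commute_sym)
    then show ?thesis by blast
  qed
  moreover have "w ! (i - 1) \<in> S" if "i \<in> {1..length w}" for i
    using that assms by auto
  moreover have "\<not> commute S R (w ! (i - 1)) (w ! (j - 1)) \<or> w ! (i - 1) = w ! (j - 1)"
    if "covers ?r j i" for i j
    using word_arrow_covers[OF that] by (auto simp: word_arrow_def)
  ultimately show ?thesis
    unfolding word_poset_def poset_of_word_def by simp
qed

text \<open>The isomorphism is the listing itself, shifted because positions start at 1. The lemma
  serves twice: to find a word for a given poset, and, with P(w) as \<open>Q\<close>, to compare w
  with a rearrangement of it.\<close>

lemma poset_of_word_linear_extension:
  assumes Q: "word_poset S R Q" and xs: "linear_extension (order_rel Q) xs" "set xs = elems Q"
  shows "word_poset_isomorphism (poset_of_word S R (map (label Q) xs)) Q (\<lambda>i. xs ! (i - 1))"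
proof -
  let ?w = "map (label Q) xs" and ?r = "order_rel Q" and ?g = "\<lambda>i. xs ! (i - 1)"
  let ?N = "{1..length xs}"
  have po: "finite (elems Q)" "partial_order_on (elems Q) ?r"
    using Q by (auto simp: word_poset_def)
  then have r: "?r \<subseteq> elems Q \<times> elems Q" "refl_on (elems Q) ?r" "trans ?r"
    by (auto simp: partial_order_on_def preorder_on_def)
  have "bij_betw (\<lambda>i. i - 1) ?N {..<length xs}"
    by (rule bij_betw_byWitness[where f' = Suc]) auto
  moreover have "bij_betw ((!) xs) {..<length xs} (elems Q)"
    using xs by (auto intro!: bij_betw_nth simp: linear_extension_def)
  ultimately have bij: "bij_betw ?g ?N (elems Q)"
    using bij_betw_trans by (fastforce simp: comp_def)
  \<comment> \<open>Positions are at least 1, so the truncated \<open>i - 1\<close> and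
    \<open>j - 1\<close> compare exactly as \<open>i\<close> and \<open>j\<close> do.\<close>
  have le: "i \<le> j" if "(?g i, ?g j) \<in> ?r" "i \<in> ?N" "j \<in> ?N" for i j
  proof -
    have "i - 1 < length xs" "j - 1 < length xs" using that(2,3) by auto
    from linear_extension_nth_le[OF xs(1) that(1) this] that(2,3) show ?thesis by auto
  qed
  have arrow: "(i, j) \<in> word_arrow S R ?w \<longleftrightarrow> i \<in> ?N \<and> j \<in> ?N \<and> i \<le> j \<and>
      (label Q (?g i) = label Q (?g j) \<or> \<not> commute S R (label Q (?g i)) (label Q (?g j)))" for i j
    by (auto simp: word_arrow_def)
  have forward: "(?g i, ?g j) \<in> ?r" if "(i, j) \<in> (word_arrow S R ?w)\<^sup>+" for i j
    using that
  proof (induction rule: trancl_induct)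
    have *: "(?g i, ?g j) \<in> ?r" if "(i, j) \<in> word_arrow S R ?w" for i j
    proof -
      have ij: "i \<in> ?N" "j \<in> ?N" "i \<le> j" using that by (auto simp: arrow)
      have el: "?g i \<in> elems Q" "?g j \<in> elems Q" using bij ij by (auto dest: bij_betwE)
      then have "(?g i, ?g j) \<in> ?r \<or> (?g j, ?g i) \<in> ?r"
        using Q that unfolding arrow word_poset_def by blast
      \<comment> \<open>By (a) the two entries are comparable. The wrong direction would give
        \<open>j \<le> i\<close>, hence \<open>i = j\<close>, and then both directions are the same
        pair.\<close>
      moreover have "i = j" if "(?g j, ?g i) \<in> ?r"
        using le[OF that] ij by auto
      ultimately show ?thesis by auto
    qed
    {
      case (base j)
      then show ?case by (rule *)
    next
      case (step j k)
      then show ?case using * transD[OF r(3)] by blast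
    }
  qed
  have backward: "(i, j) \<in> (word_arrow S R ?w)\<^sup>+"
    if "(?g i, ?g j) \<in> ?r" "i \<in> ?N" "j \<in> ?N" for i j
  proof -
    \<comment> \<open>The induction follows a chain of covers through elements of \<open>Q\<close>;
      each element reached is translated back into its position \<open>j\<close>.\<close>
    have "\<forall>j \<in> ?N. y = ?g j \<longrightarrow> (i, j) \<in> (word_arrow S R ?w)\<^sup>+"
      if "(?g i, y) \<in> {(u, v). covers ?r v u}\<^sup>*" for y
      using that
    proof (induction rule: rtrancl_induct)
      case base
      \<comment> \<open>The chain of covers may be empty while \<open>trancl\<close> needs at least
        one step; the loop at \<open>i\<close> supplies it.\<close>
      have "(i, i) \<in> word_arrow S R ?w" using \<open>i \<in> ?N\<close> by (simp add: arrow)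
      moreover have "j = i" if "j \<in> ?N" "?g i = ?g j" for j
        using inj_onD[OF bij_betw_imp_inj_on[OF bij] that(2) \<open>i \<in> ?N\<close> that(1)] by simp
      ultimately show ?case by blast
    next
      case (step y z)
      show ?case
      proof (intro ballI impI)
        fix j assume j: "j \<in> ?N" "z = ?g j"
        have yz: "(y, z) \<in> ?r" "covers ?r z y" using step by (auto simp: covers_def)
        then have "y \<in> elems Q" "z \<in> elems Q" using r(1) by auto
        then obtain k where k: "k \<in> ?N" "y = ?g k"
          using bij_betw_imp_surj_on[OF bij] by blast
        \<comment> \<open>Condition (b) provides the label part of the arrow from \<open>k\<close>
          to \<open>j\<close>, and \<open>le\<close> the order of the positions.\<close>
        have "\<not> commute S R (label Q y) (label Q z) \<or> label Q y = label Q z"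
          using Q yz \<open>y \<in> elems Q\<close> \<open>z \<in> elems Q\<close> unfolding word_poset_def by blast
        moreover have "k \<le> j" using le yz(1) j k by blast
        ultimately have "(k, j) \<in> word_arrow S R ?w" unfolding arrow using j k by auto
        then show "(i, j) \<in> (word_arrow S R ?w)\<^sup>+"
          by (rule trancl_into_trancl[rotated]) (use step.IH k in blast)
      qed
    qed
    then show ?thesis
      using finite_order_generated_by_covers[OF po that(1)] that(3) by blast
  qed
  show ?thesis
    unfolding word_poset_isomorphism_def poset_of_word_def
    using bij forward backward by auto
qed

lemma word_poset_isomorphic_to_poset_of_word:
  assumes "word_poset S R Q"
  shows "\<exists>w \<in> lists S. word_poset_isomorphic (poset_of_word S R w) Q"
proof -
  have "finite (elems Q)" "antisym (order_rel Q)" "trans (order_rel Q)"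
    using assms by (auto simp: word_poset_def partial_order_on_def preorder_on_def)
  then obtain xs where xs: "set xs = elems Q" "linear_extension (order_rel Q) xs"
    using ex_linear_extension by blast
  have "map (label Q) xs \<in> lists S"
    using assms xs(1) by (auto simp: word_poset_def)
  then show ?thesis
    using poset_of_word_linear_extension[OF assms xs(2,1)]
    unfolding word_poset_isomorphic_def by blast
qed

section \<open>Isomorphism classes of word posets\<close>

lemma word_poset_isomorphic_refl: "word_poset_isomorphic P P"
  unfolding word_poset_isomorphic_def word_poset_isomorphism_def
  by (rule exI[of _ id]) auto

lemma word_poset_isomorphism_inv_into:
  assumes "word_poset_isomorphism P Q f"
  shows "word_poset_isomorphism Q P (inv_into (elems P) f)"
proof -
  have bij: "bij_betw f (elems P) (elems Q)"
    using assms by (simp add: word_poset_isomorphism_def)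
  let ?g = "inv_into (elems P) f"
  have g: "bij_betw ?g (elems Q) (elems P)" using bij by (rule bij_betw_inv_into)
  then have "?g u \<in> elems P" "f (?g u) = u" if "u \<in> elems Q" for u
    using that bij by (auto dest: bij_betwE simp: bij_betw_inv_into_right)
  then show ?thesis
    using assms g unfolding word_poset_isomorphism_def by metis
qed

lemma word_poset_isomorphic_trans:
  assumes "word_poset_isomorphic P Q" "word_poset_isomorphic Q T"
  shows "word_poset_isomorphic P T"
proof -
  obtain f g where fg: "word_poset_isomorphism P Q f" "word_poset_isomorphism Q T g"
    using assms by (auto simp: word_poset_isomorphic_def)
  then have "f u \<in> elems Q" if "u \<in> elems P" for u
    using that by (auto simp: word_poset_isomorphism_def dest: bij_betwE)
  then have "word_poset_isomorphism P T (g \<circ> f)"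
    using fg unfolding word_poset_isomorphism_def by (auto intro: bij_betw_trans)
  then show ?thesis unfolding word_poset_isomorphic_def by blast
qed

lemma equiv_isomorphism_rel: "equiv {P. word_poset S R P} (isomorphism_rel S R)"
proof (rule equivI)
  show "sym (isomorphism_rel S R)"
    unfolding isomorphism_rel_def sym_def word_poset_isomorphic_def
    using word_poset_isomorphism_inv_into by blast
  show "trans (isomorphism_rel S R)"
    unfolding isomorphism_rel_def trans_def using word_poset_isomorphic_trans by blast
qed (auto simp: isomorphism_rel_def refl_on_def word_poset_isomorphic_refl)

section \<open>Commutation equivalence and isomorphism of the posets P(w)\<close>

lemma map_nth_pred_upt: "map (\<lambda>i. w ! (i - 1)) [1..<Suc (length w)] = w"
  by (rule nth_equalityI) (auto simp del: upt_Suc)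

text \<open>The word \<open>w'\<close> is read off from P(w) along the increasing list of positions
  with the two moved positions exchanged. These are incomparable, so the list remains a linear
  extension.\<close>

lemma commutation_move_isomorphic:
  assumes "(w, w') \<in> commutation_move S R"
  shows "word_poset_isomorphic (poset_of_word S R w') (poset_of_word S R w)"
proof -
  obtain u v a b where w: "w = u @ [a, b] @ v" "w' = u @ [b, a] @ v"
    and S: "u \<in> lists S" "v \<in> lists S" and ab: "commute S R a b"
    using assms unfolding commutation_move_def by blast
  show ?thesis
  \<comment> \<open>A letter commutes with itself, so a move may exchange equal letters. Their
    positions are comparable, but the word does not change.\<close>
  proof (cases "a = b")
    case True
    then show ?thesis using w by (simp add: word_poset_isomorphic_refl)
  next
    case False
    let ?k = "length u"
    \<comment> \<open>Counting from 1, the letters \<open>a\<close> and \<open>b\<close> of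
      \<open>w\<close> sit at positions \<open>?k + 1\<close> and \<open>?k + 2\<close>.\<close>
    let ?xs = "[1..<Suc ?k] @ [?k + 2, ?k + 1] @ [?k + 3..<Suc (length w)]"
    let ?P = "poset_of_word S R w"
    have wS: "w \<in> lists S"
      using S ab unfolding w commute_def by auto
    \<comment> \<open>No position lies between neighbours, so if comparable they would form a
      covering pair and be joined by an arrow; distinct commuting letters forbid that.\<close>
    have "(?k + 1, ?k + 2) \<notin> (word_arrow S R w)\<^sup>+"
    proof
      assume "(?k + 1, ?k + 2) \<in> (word_arrow S R w)\<^sup>+"
      then have "covers ((word_arrow S R w)\<^sup>+) (?k + 2) (?k + 1)"
        by (force simp: covers_def dest: word_arrow_trancl_le)
      then have "(?k + 1, ?k + 2) \<in> word_arrow S R w" by (rule word_arrow_covers)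
      then show False using ab False by (auto simp: word_arrow_def w nth_append)
    qed
    moreover have "sorted_wrt (\<lambda>i j. (j, i) \<notin> (word_arrow S R w)\<^sup>+) [m..<n]" for m n
      by (rule sorted_wrt_mono_rel[OF _ sorted_wrt_upt]) (auto dest: word_arrow_trancl_le)
    ultimately have "linear_extension ((word_arrow S R w)\<^sup>+) ?xs"
      unfolding linear_extension_def
      by (auto simp: sorted_wrt_append simp del: upt_Suc dest: word_arrow_trancl_le)
    moreover have "set ?xs = {1..length w}"
      unfolding w by auto
    moreover have "map (\<lambda>i. w ! (i - 1)) ?xs = w'"
      unfolding w by (rule nth_equalityI) (auto simp: nth_append nth_Cons' simp del: upt_Suc)
    ultimately have "word_poset_isomorphism (poset_of_word S R w') ?P (\<lambda>i. ?xs ! (i - 1))"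
      using poset_of_word_linear_extension[OF word_poset_poset_of_word[OF wS, of R], of ?xs]
      by (simp add: poset_of_word_def del: upt_Suc)
    then show ?thesis unfolding word_poset_isomorphic_def by blast
  qed
qed

lemma commutation_equiv_isomorphic:
  assumes "(w, w') \<in> commutation_equiv S R"
  shows "word_poset_isomorphic (poset_of_word S R w') (poset_of_word S R w)"
proof -
  have "(w, w') \<in> (commutation_move S R)\<^sup>*"
    using assms by (simp add: commutation_equiv_def)
  then show ?thesis
    by (induction rule: rtrancl_induct)
      (auto intro: word_poset_isomorphic_refl word_poset_isomorphic_trans
        commutation_move_isomorphic)
qed

text \<open>The isomorphism \<open>f\<close> from P(w') to P(w) carries the increasing list of
  positions of \<open>w'\<close> to a linear extension of P(w) that spells \<open>w'\<close>. The
  increasing list of positions of \<open>w\<close> spells \<open>w\<close>, and two linear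
  extensions of P(w) spell equivalent words.\<close>

lemma isomorphic_commutation_equiv:
  assumes "w \<in> lists S" "w' \<in> lists S"
    and "word_poset_isomorphic (poset_of_word S R w') (poset_of_word S R w)"
  shows "(w, w') \<in> commutation_equiv S R"
proof -
  let ?r = "(word_arrow S R w)\<^sup>+" and ?r' = "(word_arrow S R w')\<^sup>+"
  obtain f where "word_poset_isomorphism (poset_of_word S R w') (poset_of_word S R w) f"
    using assms(3) unfolding word_poset_isomorphic_def by blast
  then have bij: "bij_betw f {1..length w'} {1..length w}"
    and iso: "\<And>i j. i \<in> {1..length w'} \<Longrightarrow> j \<in> {1..length w'} \<Longrightarrow> (i, j) \<in> ?r' \<longleftrightarrow> (f i, f j) \<in> ?r"
    and lab: "\<And>i. i \<in> {1..length w'} \<Longrightarrow> w ! (f i - 1) = w' ! (i - 1)"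
    unfolding word_poset_isomorphism_def poset_of_word_def by auto
  let ?xs = "[1..<Suc (length w)]" and ?ys = "map f [1..<Suc (length w')]"
  let ?l = "\<lambda>i. w ! (i - 1)"
  have sets: "set [1..<Suc n] = {1..n}" for n by auto
  have upt: "sorted_wrt (\<lambda>i j. (j, i) \<notin> (word_arrow S R v)\<^sup>+) [m..<n]" for v m n
    by (rule sorted_wrt_mono_rel[OF _ sorted_wrt_upt]) (auto dest: word_arrow_trancl_le)
  have "(map ?l ?xs, map ?l ?ys) \<in> (commutation_move S R)\<^sup>*"
  proof (rule linear_extensions_commutation_equivalent)
    show "linear_extension ?r ?xs"
      using upt by (simp add: linear_extension_def del: upt_Suc)
    have "sorted_wrt (\<lambda>i j. (f j, f i) \<notin> ?r) [1..<Suc (length w')]"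
      by (rule sorted_wrt_mono_rel[OF _ upt[of w']]) (use iso sets in auto)
    then show "linear_extension ?r ?ys"
      using bij unfolding linear_extension_def sorted_wrt_map distinct_map sets bij_betw_def
      by simp
    show "set ?xs = set ?ys"
      using bij by (simp only: set_map sets bij_betw_def)
    show "?l ` set ?xs \<subseteq> S"
      unfolding sets using assms(1) by auto
    show "(i, j) \<in> ?r \<or> (j, i) \<in> ?r"
      if "i \<in> set ?xs" "j \<in> set ?xs" "\<not> commute S R (?l i) (?l j)" for i j
      using word_poset_poset_of_word[OF assms(1), of R] that
      unfolding word_poset_def poset_of_word_def sets by auto
  qed
  moreover have "map ?l ?ys = map (\<lambda>i. w' ! (i - 1)) [1..<Suc (length w')]"
    using lab by auto
  ultimately show ?thesis
    using assms(1,2) unfolding map_nth_pred_upt commutation_equiv_def by simp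
qed

section \<open>The bijection of classes\<close>

theorem theorem1p2:
  fixes S :: "'a set" and R :: "('a list \<times> 'a list) set"
  assumes "R \<subseteq> lists S \<times> lists S"
  shows "(\<exists>\<Phi> :: 'a list set \<Rightarrow> (nat, 'a) labelled_poset set.
            (\<forall>w\<in>lists S. \<Phi> (commutation_equiv S R `` {w}) =
               isomorphism_rel S R `` {poset_of_word S R w}) \<and>
            bij_betw \<Phi> (lists S // commutation_equiv S R)
              ({P. word_poset S R P} // isomorphism_rel S R)) \<and>
         (\<forall>Q :: ('p, 'a) labelled_poset. word_poset S R Q \<longrightarrow>
            (\<exists>w\<in>lists S. word_poset_isomorphic (poset_of_word S R w) Q))"
proof (intro conjI allI impI)
  let ?C = "commutation_equiv S R" and ?P = "poset_of_word S R"
  let ?I = "isomorphism_rel S R :: ((nat, 'a) labelled_poset \<times> (nat, 'a) labelled_poset) set"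
  \<comment> \<open>Taking the union over all words of the class avoids choosing a
    representative.\<close>
  let ?\<Phi> = "\<lambda>X. ?I `` (?P ` X)"
  have sym_C: "sym ?C"
    by (rule equivE[OF equiv_commutation_equiv])
  have sym_I: "sym ?I"
    by (rule equivE[OF equiv_isomorphism_rel])
  \<comment> \<open>One direction makes the map well defined, the other makes it injective.\<close>
  have rel_iff: "(?P w, ?P w') \<in> ?I \<longleftrightarrow> (w, w') \<in> ?C"
    if "w \<in> lists S" "w' \<in> lists S" for w w'
  proof
    assume "(?P w, ?P w') \<in> ?I"
    then have "(w', w) \<in> ?C"
      using isomorphic_commutation_equiv[OF that(2,1)] by (auto simp: isomorphism_rel_def)
    with sym_C show "(w, w') \<in> ?C" by (rule symD)
  next
    assume "(w, w') \<in> ?C"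
    from commutation_equiv_isomorphic[OF this] have "(?P w', ?P w) \<in> ?I"
      using word_poset_poset_of_word[OF that(1)] word_poset_poset_of_word[OF that(2)]
      by (simp add: isomorphism_rel_def)
    with sym_I show "(?P w, ?P w') \<in> ?I" by (rule symD)
  qed
  \<comment> \<open>All words of the class contribute the same isomorphism class, and
    \<open>w\<close> is among them, so the union collapses to that class.\<close>
  have cls: "?\<Phi> (?C `` {w}) = ?I `` {?P w}" if w: "w \<in> lists S" for w
  proof -
    have "w \<in> ?C `` {w}"
      using equiv_class_self[OF equiv_commutation_equiv w] .
    moreover have "?I `` {?P v} = ?I `` {?P w}" if "v \<in> ?C `` {w}" for v
    proof -
      have "v \<in> lists S" using that by (simp add: commutation_equiv_def)
      then have "(?P w, ?P v) \<in> ?I" using rel_iff w that by blast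
      from equiv_class_eq[OF equiv_isomorphism_rel this] show ?thesis by simp
    qed
    ultimately show ?thesis by blast
  qed
  have "bij_betw ?\<Phi> (lists S // ?C) ({P. word_poset S R P} // ?I)"
  proof (rule bij_betw_imageI)
    show "inj_on ?\<Phi> (lists S // ?C)"
    proof (rule inj_onI)
      fix X Y assume X: "X \<in> lists S // ?C" and Y: "Y \<in> lists S // ?C" and eq: "?\<Phi> X = ?\<Phi> Y"
      obtain v w where v: "v \<in> lists S" "X = ?C `` {v}" and w: "w \<in> lists S" "Y = ?C `` {w}"
        using X Y by (meson quotientE)
      have "?I `` {?P v} = ?I `` {?P w}"
        using eq unfolding v(2) w(2) cls[OF v(1)] cls[OF w(1)] .
      then have "(?P v, ?P w) \<in> ?I"
        by (rule eq_equiv_class[OF _ equiv_isomorphism_rel])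
          (use word_poset_poset_of_word[OF w(1)] in simp)
      then have "(v, w) \<in> ?C" using rel_iff v w by blast
      then show "X = Y"
        unfolding v(2) w(2) by (rule equiv_class_eq[OF equiv_commutation_equiv])
    qed
    show "?\<Phi> ` (lists S // ?C) = {P. word_poset S R P} // ?I"
    proof
      show "?\<Phi> ` (lists S // ?C) \<subseteq> {P. word_poset S R P} // ?I"
      proof
        fix Z assume "Z \<in> ?\<Phi> ` (lists S // ?C)"
        then obtain X where X: "Z = ?\<Phi> X" "X \<in> lists S // ?C" by (rule imageE)
        from X(2) obtain w where "w \<in> lists S" "X = ?C `` {w}" by (rule quotientE)
        with X(1) have w: "w \<in> lists S" "Z = ?\<Phi> (?C `` {w})" by simp_all
        show "Z \<in> {P. word_poset S R P} // ?I"
          unfolding w(2) cls[OF w(1)]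
          by (rule quotientI) (use word_poset_poset_of_word[OF w(1)] in simp)
      qed
      show "{P. word_poset S R P} // ?I \<subseteq> ?\<Phi> ` (lists S // ?C)"
      proof
        fix Z assume "Z \<in> {P. word_poset S R P} // ?I"
        then obtain Q where "Q \<in> {P. word_poset S R P}" and Z: "Z = ?I `` {Q}"
          by (rule quotientE)
        then have Q: "word_poset S R Q" by simp
        obtain w where w: "w \<in> lists S" "word_poset_isomorphic (?P w) Q"
          using word_poset_isomorphic_to_poset_of_word[OF Q] by blast
        then have "(?P w, Q) \<in> ?I"
          using Q word_poset_poset_of_word[OF w(1)] by (simp add: isomorphism_rel_def)
        from equiv_class_eq[OF equiv_isomorphism_rel this]
        have "Z = ?\<Phi> (?C `` {w})" unfolding cls[OF w(1)] Z by simp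
        then show "Z \<in> ?\<Phi> ` (lists S // ?C)"
          by (rule image_eqI[OF _ quotientI[OF w(1)]])
      qed
    qed
  qed
  then show "\<exists>\<Phi>. (\<forall>w\<in>lists S. \<Phi> (?C `` {w}) = ?I `` {?P w}) \<and>
      bij_betw \<Phi> (lists S // ?C) ({P. word_poset S R P} // ?I)"
    using cls by (intro exI[of _ ?\<Phi>] conjI ballI)
next
  \<comment> \<open>The bijection concerns posets whose elements are natural numbers. This clause
    shows that word posets on any other type yield no further isomorphism classes.\<close>
  fix Q :: "('p, 'a) labelled_poset"
  assume "word_poset S R Q"
  then show "\<exists>w\<in>lists S. word_poset_isomorphic (poset_of_word S R w) Q"
    by (rule word_poset_isomorphic_to_poset_of_word)
qed

end
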